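(* Let $\mu>0$ and let $\hat r:[0,\infty)\to\mathbb{R}$ be a concave and non-decreasing function with $\hat r(0)=0$. For $\sigma_i\ge 0$ let $$y_i^*\in\arg\min_{y_i\ge 0}\ \tfrac12 (y_i-\sigma_i)^2+\mu\,\hat r(y_i).$$ Then there exists a threshold $\gamma>0$ such that $y_i^*=0$ whenever $\sigma_i\le\gamma$.
   Context: The $\sigma_i$ are the singular values of a matrix $X\in\mathbb{R}^{m\times n}$, $m\le n$, and the scalar problems arise from the proximal operator of the low-rank regularizer $r(X)=\sum_{i=1}^m\hat r(\sigma_i)$. $\hat r$ may be nonsmooth.
   Formalization: The function r̂ is additionally assumed not to vanish identically on [0,∞); for r̂ = 0 the minimizer is y* = σ, so no threshold γ > 0 exists and the statement as printed fails. *)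

theory Defs
  imports "HOL-Analysis.Analysis"
begin

definition prox_objective :: "real \<Rightarrow> (real \<Rightarrow> real) \<Rightarrow> real \<Rightarrow> real \<Rightarrow> real" where
  "prox_objective \<mu> r \<sigma> y = 1/2 * (y - \<sigma>)\<^sup>2 + \<mu> * r y"

end

theory Submission
  imports Defs
begin

text \<open>Comparing a minimizer \<open>y\<close> with the competitor \<open>0\<close> gives
  \<open>y\<^sup>2 / 2 + \<mu> * r y \<le> \<sigma> * y\<close>, hence \<open>y \<le> 2 * \<sigma>\<close>. Choose \<open>t > 0\<close> with \<open>r t > 0\<close>.
  By concavity \<open>r\<close> lies above its chord on \<open>[0, t]\<close>, so if \<open>0 < y \<le> t\<close> then the slope
  \<open>\<mu> * r t / t\<close> is strictly less than \<open>\<sigma>\<close>.\<close>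

theorem mainTheorem1:
  fixes \<mu> :: real and r :: "real \<Rightarrow> real"
  assumes "\<mu> > 0"
    and "concave_on {0..} r"
    and "mono_on {0..} r"
    and "r 0 = 0"
    and r_nonzero: "\<exists>t\<ge>0. r t \<noteq> 0"
  shows "\<exists>\<gamma>>0. \<forall>\<sigma>\<ge>0. \<forall>y. is_arg_min (prox_objective \<mu> r \<sigma>) (\<lambda>y. 0 \<le> y) y
           \<longrightarrow> \<sigma> \<le> \<gamma> \<longrightarrow> y = 0"
proof -
  have nonneg: "0 \<le> r x" if "0 \<le> x" for x
    using mono_onD[OF assms(3), of 0 x] that \<open>r 0 = 0\<close> by simp
  \<comment> \<open>If \<open>r\<close> vanished on all of \<open>{0..}\<close>, the minimizer would
    be \<open>\<sigma>\<close> itself and no threshold could exist.\<close>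
  obtain t where "t \<ge> 0" "r t \<noteq> 0"
    using r_nonzero by blast
  then have t: "t > 0" and rt: "r t > 0"
    using \<open>r 0 = 0\<close> nonneg[of t] by (auto simp: less_le)
  define k where "k = r t / t"
  \<comment> \<open>The bound \<open>t / 2\<close> forces
    \<open>y \<le> 2 * \<sigma> \<le> t\<close>, the range where the chord lies below
    \<open>r\<close>; the bound \<open>\<mu> * k\<close> is what the slope estimate then
    contradicts.\<close>
  define \<gamma> where "\<gamma> = min (t / 2) (\<mu> * k)"
  have "k > 0"
    using t rt by (simp add: k_def)
  then have "\<gamma> > 0"
    using t \<open>\<mu> > 0\<close> by (simp add: \<gamma>_def)
  moreover have "y = 0"
    if min: "is_arg_min (prox_objective \<mu> r \<sigma>) (\<lambda>y. 0 \<le> y) y" and "\<sigma> \<le> \<gamma>" for \<sigma> y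
  proof (rule ccontr)
    assume "y \<noteq> 0"
    with min have "y > 0"
      by (simp add: is_arg_min_def)
    have "prox_objective \<mu> r \<sigma> y \<le> prox_objective \<mu> r \<sigma> 0"
      using min by (auto simp: is_arg_min_def not_less)
    then have le: "y * y / 2 + \<mu> * r y \<le> \<sigma> * y"
      using \<open>r 0 = 0\<close> by (simp add: prox_objective_def power2_eq_square field_simps)
    have "0 \<le> \<mu> * r y"
      using \<open>\<mu> > 0\<close> \<open>y > 0\<close> nonneg[of y] by simp
    with le have "(y / 2) * y \<le> \<sigma> * y"
      by simp
    then have "y / 2 \<le> \<sigma>"
      using \<open>y > 0\<close> by (rule mult_right_le_imp_le)
    with \<open>\<sigma> \<le> \<gamma>\<close> have "y \<le> t"
      by (simp add: \<gamma>_def)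
    have "(1 - y / t) * r 0 + (y / t) * r t \<le> r ((1 - y / t) *\<^sub>R 0 + (y / t) *\<^sub>R t)"
      using \<open>y > 0\<close> \<open>y \<le> t\<close> t by (intro concave_onD[OF assms(2)]) auto
    then have "k * y \<le> r y"
      using t \<open>r 0 = 0\<close> by (simp add: k_def mult.commute)
    then have "\<mu> * (k * y) \<le> \<mu> * r y"
      using \<open>\<mu> > 0\<close> by simp
    moreover have "0 < y * y / 2"
      using \<open>y > 0\<close> by simp
    \<comment> \<open>Dropping the positive quadratic term makes this strict, so the case
      \<open>\<sigma> = \<gamma>\<close> is covered too.\<close>
    ultimately have "(\<mu> * k) * y < \<sigma> * y"
      using le by (simp add: mult.assoc)
    then have "\<mu> * k < \<sigma>"
      using \<open>y > 0\<close> by simp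
    with \<open>\<sigma> \<le> \<gamma>\<close> show False
      by (simp add: \<gamma>_def)
  qed
  ultimately show ?thesis
    by blast
qed

end
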